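(* Let $\lambda>-1$ and $t\in\mathbb{R}$, and let $P_n(x)=P_n(x;t,\lambda)$, $n\ge0$, be the monic orthogonal polynomials with respect to the generalised Airy weight $\omega(x;t,\lambda)=x^{\lambda}\exp(-\tfrac13x^3+tx)$ on $(0,\infty)$, with three-term recurrence coefficients $\alpha_n=\alpha_n(t;\lambda)$ and $\beta_n=\beta_n(t;\lambda)$. Then for every $n\ge0$, as an identity of rational functions of $x$, $$\frac{\mathrm{d}^2P_n}{\mathrm{d}x^2}(x)+\mathcal{Q}_n(x)\frac{\mathrm{d}P_n}{\mathrm{d}x}(x)+\mathcal{T}_n(x)P_n(x)=0,$$ where $$\mathcal{Q}_n(x)=\frac{\lambda+tx-x^3+1}{x}-\frac{\alpha_n+2x}{\mathcal{C}_n(x)},$$ \begin{align*} \mathcal{T}_n(x)=\;&\frac{n-(\alpha_{n-1}+\alpha_n)\beta_n-\left(\beta_n\mathcal{D}_n(x)-n\right)\left(-\lambda+\beta_n\mathcal{D}_n(x)-n-tx+x^3\right)+\beta_n\mathcal{C}_{n-1}(x)\mathcal{C}_n(x)}{x^2}\\ &+\frac{\left(n-\beta_n\mathcal{D}_n(x)\right)\left(x^2-\alpha_n^2-\beta_n-\beta_{n+1}+t\right)}{x^2\,\mathcal{C}_n(x)}, \end{align*} with $$\mathcal{C}_n(x)=x^2+\beta_n+\beta_{n+1}+\alpha_n(\alpha_n+x)-t,\qquad \mathcal{D}_n(x)=\alpha_{n-1}+\alpha_n+x.$$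
   Context: The generalised Airy weight is $\omega(x;t,\lambda)=x^{\lambda}\exp(-\tfrac13x^3+tx)$, $x\in(0,\infty)$, $\lambda>-1$, $t\in\mathbb{R}$. $P_n(x;t,\lambda)$ is the monic polynomial of degree $n$ with $\int_0^\infty P_m(x;t,\lambda)P_n(x;t,\lambda)\,\omega(x;t,\lambda)\,\mathrm{d}x=0$ for $m\ne n$. The recurrence coefficients $\alpha_n(t;\lambda)$, $\beta_n(t;\lambda)$ are defined by $xP_n(x)=P_{n+1}(x)+\alpha_nP_n(x)+\beta_nP_{n-1}(x)$ with $P_{-1}=0$, $P_0=1$ (so $\beta_n>0$ for $n\ge1$), with the conventions $\beta_0=0$ and $\alpha_{-1}=\beta_{-1}=0$. *)

theory Defs
  imports
    "HOL-Analysis.Analysis"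
    "HOL-Computational_Algebra.Computational_Algebra"
begin

definition gen_airy_weight :: "real \<Rightarrow> real \<Rightarrow> real \<Rightarrow> real" where
  "gen_airy_weight t lam x = x powr lam * exp (- (1/3) * x ^ 3 + t * x)"

definition monic_orthogonal_polys :: "(real \<Rightarrow> real) \<Rightarrow> (nat \<Rightarrow> real poly) \<Rightarrow> bool" where
  "monic_orthogonal_polys w P \<longleftrightarrow>
     (\<forall>n. degree (P n) = n \<and> lead_coeff (P n) = 1) \<and>
     (\<forall>m n. m \<noteq> n \<longrightarrow> (LINT x:{0<..}|lborel. poly (P m) x * poly (P n) x * w x) = 0)"

(* The coefficient sequences are indexed by int so that the conventions at index -1 can be
   stated; their values below -1 are irrelevant. The case distinction encodes P_{-1} = 0. *)
definition recurrence_coeffs ::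
    "(nat \<Rightarrow> real poly) \<Rightarrow> (int \<Rightarrow> real) \<Rightarrow> (int \<Rightarrow> real) \<Rightarrow> bool" where
  "recurrence_coeffs P \<alpha> \<beta> \<longleftrightarrow>
     (\<forall>n. [:0, 1:] * P n =
        P (Suc n) + smult (\<alpha> (int n)) (P n)
          + smult (\<beta> (int n)) (if n = 0 then 0 else P (n - 1))) \<and>
     \<beta> 0 = 0 \<and> \<alpha> (-1) = 0 \<and> \<beta> (-1) = 0"

(* The field of rational functions R(x) is the fraction field of R[x]. *)
type_synonym ratfun = "real poly fract"

abbreviation rf_const :: "real \<Rightarrow> ratfun" where
  "rf_const c \<equiv> to_fract [:c:]"

abbreviation rf_X :: ratfun where
  "rf_X \<equiv> to_fract [:0, 1:]"

definition airy_C :: "real \<Rightarrow> (int \<Rightarrow> real) \<Rightarrow> (int \<Rightarrow> real) \<Rightarrow> int \<Rightarrow> ratfun" where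
  "airy_C t \<alpha> \<beta> n =
     rf_X ^ 2 + rf_const (\<beta> n) + rf_const (\<beta> (n + 1))
       + rf_const (\<alpha> n) * (rf_const (\<alpha> n) + rf_X) - rf_const t"

definition airy_D :: "(int \<Rightarrow> real) \<Rightarrow> int \<Rightarrow> ratfun" where
  "airy_D \<alpha> n = rf_const (\<alpha> (n - 1)) + rf_const (\<alpha> n) + rf_X"

definition airy_Q ::
    "real \<Rightarrow> real \<Rightarrow> (int \<Rightarrow> real) \<Rightarrow> (int \<Rightarrow> real) \<Rightarrow> int \<Rightarrow> ratfun" where
  "airy_Q t lam \<alpha> \<beta> n =
     (rf_const lam + rf_const t * rf_X - rf_X ^ 3 + 1) / rf_X
       - (rf_const (\<alpha> n) + 2 * rf_X) / airy_C t \<alpha> \<beta> n"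

definition airy_T ::
    "real \<Rightarrow> real \<Rightarrow> (int \<Rightarrow> real) \<Rightarrow> (int \<Rightarrow> real) \<Rightarrow> int \<Rightarrow> ratfun" where
  "airy_T t lam \<alpha> \<beta> n =
     (of_int n - rf_const ((\<alpha> (n - 1) + \<alpha> n) * \<beta> n)
        - (rf_const (\<beta> n) * airy_D \<alpha> n - of_int n)
            * (- rf_const lam + rf_const (\<beta> n) * airy_D \<alpha> n - of_int n
                 - rf_const t * rf_X + rf_X ^ 3)
        + rf_const (\<beta> n) * airy_C t \<alpha> \<beta> (n - 1) * airy_C t \<alpha> \<beta> n)
       / rf_X ^ 2
     + (of_int n - rf_const (\<beta> n) * airy_D \<alpha> n)
         * (rf_X ^ 2 - rf_const ((\<alpha> n)\<^sup>2) - rf_const (\<beta> n) - rf_const (\<beta> (n + 1)) + rf_const t)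
       / (rf_X ^ 2 * airy_C t \<alpha> \<beta> n)"

end

theory Submission
  imports Defs "HOL-Real_Asymp.Real_Asymp"
begin

text \<open>
  The weight \<open>w\<close> satisfies the Pearson equation
  \<open>(x w)' = (\<lambda> + 1 + t x - x\<^sup>3) w\<close> with a polynomial on the right, and \<open>x w p\<close> vanishes at both
  ends of the half line for every polynomial \<open>p\<close>.  Hence the moment functional
  \<open>L p = \<integral> p w\<close> annihilates \<open>x p' + (\<lambda> + 1 + t x - x\<^sup>3) p\<close>.  From this
  identity, the positivity of \<open>L (p\<^sup>2)\<close> and the three-term recurrence, everything else is algebra, and
  the locale \<open>semiclassical_airy\<close> collects exactly these properties of \<open>L\<close>.

  Write \<open>B\<^sub>n = n - \<beta>\<^sub>n D\<^sub>n\<close> and \<open>V = x\<^sup>3 - t x - \<lambda>\<close>, which is \<open>x\<close> times the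
  derivative of the potential \<open>- ln w\<close>.  The heart of the proof is a pair of first-order relations:

    \<^item> \<open>x P\<^sub>n' = B\<^sub>n P\<^sub>n + \<beta>\<^sub>n C\<^sub>n P\<^sub>n\<^sub>-\<^sub>1\<close> (\<open>structure_relation\<close>).  The difference of the two
      sides has degree below \<open>n\<close>, because the leading terms cancel.  Integrating by parts
      with the Pearson identity shows that it is orthogonal to all polynomials of degree below \<open>n\<close>,
      in particular to itself, so it is zero.

    \<^item> \<open>x P\<^sub>n\<^sub>-\<^sub>1' = (V - B\<^sub>n) P\<^sub>n\<^sub>-\<^sub>1 - C\<^sub>n\<^sub>-\<^sub>1 P\<^sub>n\<close> (\<open>lower_structure_relation\<close>).  This is the first
      relation at index \<open>n - 1\<close>, with \<open>P\<^sub>n\<^sub>-\<^sub>2\<close> removed by the recurrence.  The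
      coefficient of \<open>P\<^sub>n\<^sub>-\<^sub>1\<close> takes this simple form because of \<open>freud_equation\<close>,
      which is the Pearson identity for \<open>p = P\<^sub>n\<^sub>-\<^sub>1\<^sup>2\<close>.

  Differentiating the first relation and eliminating \<open>P\<^sub>n\<^sub>-\<^sub>1\<close> and its derivative by
  means of both gives a differential equation with polynomial coefficients
  (\<open>polynomial_ode\<close>).  Division by \<open>x\<^sup>2 C\<^sub>n\<close> in the field of rational functions turns
  it into the stated one.
\<close>

section \<open>The moment functional of the generalised Airy weight\<close>

text \<open>
  The cubic in the exponent beats every linear term, so up to a constant factor the integrand lies below
  the Gamma integrand \<open>x powr a * exp (- x)\<close>.
\<close>

lemma airy_moment_integrable:
  assumes a: "a > -1"
  shows "set_integrable lborel {0<..} (\<lambda>x::real. x powr a * exp (- (1/3) * x ^ 3 + t * x))"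
proof -
  define f where "f = (\<lambda>x::real. x powr a * exp (- (1/3) * x ^ 3 + t * x))"
  define g where "g = (\<lambda>x::real. x powr (a + 1 - 1) / exp x)"
  \<comment> \<open>The constant comes from \<open>(t + 1) x \<le> (t + 1)\<^sup>2 + x\<^sup>2 / 4\<close> and \<open>x\<^sup>2 / 4 \<le> x\<^sup>3 / 3 + 1\<close>.\<close>
  define K where "K = exp ((t+1)\<^sup>2 + 1)"
  have "(g has_integral Gamma (a+1)) {0..}"
    unfolding g_def by (rule Gamma_integral_real) (use a in simp)
  hence "g absolutely_integrable_on {0..}"
    by (intro nonnegative_absolutely_integrable_1) (auto simp: g_def integrable_on_def)
  hence "set_integrable lebesgue {0<..} g"
    by (rule set_integrable_subset) auto
  moreover have "(\<lambda>x. indicator {0<..} x *\<^sub>R g x) \<in> borel_measurable lborel"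
    unfolding g_def by measurable
  ultimately have g: "set_integrable lborel {0<..} g"
    unfolding set_integrable_def using integrable_completion by blast
  have K: "exp (- (1/3) * x ^ 3 + t * x) \<le> K * exp (-x)" if "x > 0" for x :: real
  proof -
    have "(t+1) * x \<le> (t+1)\<^sup>2 + x\<^sup>2/4"
      using zero_le_power2[of "(t+1) - x/2"] by (simp add: power2_eq_square algebra_simps)
    moreover have "x\<^sup>2/4 \<le> x^3/3 + 1"
    proof (cases "x \<le> 1")
      case True
      then have "x\<^sup>2 \<le> 1" using that by (simp add: power_le_one)
      moreover have "x^3 \<ge> 0" using that by simp
      ultimately show ?thesis by linarith
    next
      case False
      then have "x\<^sup>2 \<le> x^3" by (intro power_increasing) auto
      moreover have "x\<^sup>2 \<ge> 0" by simp
      ultimately show ?thesis by linarith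
    qed
    ultimately have "- (1/3) * x ^ 3 + t * x \<le> ((t+1)\<^sup>2 + 1) + (-x)"
      by (simp add: algebra_simps)
    thus ?thesis unfolding K_def by (simp flip: exp_add)
  qed
  have Kg: "set_integrable lborel {0<..} (\<lambda>x. K * g x)"
    using g by simp
  have "set_integrable lborel {0<..} f"
  proof (rule set_integrable_bound[OF Kg])
    show "set_borel_measurable lborel {0<..} f"
      unfolding f_def set_borel_measurable_def by measurable
    show "AE x in lborel. x \<in> {0<..} \<longrightarrow> norm (f x) \<le> norm (K * g x)"
    proof (intro AE_I2 impI)
      fix x :: real assume "x \<in> {0<..}"
      hence x: "x > 0" by simp
      have "f x \<le> x powr a * (K * exp (-x))"
        unfolding f_def by (intro mult_left_mono K x) simp
      thus "norm (f x) \<le> norm (K * g x)"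
        by (simp add: f_def g_def K_def exp_minus field_simps)
    qed
  qed
  thus ?thesis unfolding f_def .
qed

lemma gen_airy_weight_times_power:
  assumes "x > 0"
  shows "x ^ k * gen_airy_weight t lam x = x powr (lam + real k) * exp (- (1/3) * x ^ 3 + t * x)"
  using assms by (simp add: gen_airy_weight_def powr_add powr_realpow)

lemma poly_times_airy_weight_integrable:
  assumes "lam > -1"
  shows "set_integrable lborel {0<..} (\<lambda>x. poly p x * gen_airy_weight t lam x)"
proof -
  have "set_integrable lborel {0<..}
          (\<lambda>x. \<Sum>k\<le>degree p. coeff p k * (x powr (lam + real k) * exp (- (1/3) * x ^ 3 + t * x)))"
    unfolding set_integrable_def scaleR_sum_right
    by (intro Bochner_Integration.integrable_sum airy_moment_integrable[unfolded set_integrable_def] 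
      set_integrable_mult_right[unfolded set_integrable_def])
      (use assms in auto)
  also have "?this \<longleftrightarrow> ?thesis"
    by (intro set_integrable_cong)
      (auto simp: poly_altdef sum_distrib_right mult.assoc gen_airy_weight_times_power)
  finally show ?thesis .
qed

definition airy_functional :: "real \<Rightarrow> real \<Rightarrow> real poly \<Rightarrow> real" where
  "airy_functional t lam p = (LINT x:{0<..}|lborel. poly p x * gen_airy_weight t lam x)"

lemma airy_functional_add:
  assumes "lam > -1"
  shows "airy_functional t lam (p + q) = airy_functional t lam p + airy_functional t lam q"
  using poly_times_airy_weight_integrable[OF assms, of p t]
    poly_times_airy_weight_integrable[OF assms, of q t]
  by (simp add: airy_functional_def distrib_right)

lemma airy_functional_smult:
  "airy_functional t lam (smult c p) = c * airy_functional t lam p"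
  by (simp add: airy_functional_def mult.assoc)

text \<open>
  If the integral of the nonnegative function \<open>p\<^sup>2 w\<close> were zero, the function would vanish almost
  everywhere; but on the half line \<open>w\<close> is positive and \<open>p\<close> has only finitely many zeros.
\<close>

lemma airy_functional_square_pos:
  assumes lam: "lam > -1" and p: "p \<noteq> 0"
  shows "airy_functional t lam (p * p) > 0"
proof -
  define f where "f = (\<lambda>x. indicator {0<..} x *\<^sub>R (poly (p * p) x * gen_airy_weight t lam x))"
  have int: "integrable lborel f"
    using poly_times_airy_weight_integrable[OF lam, of "p * p" t]
    unfolding set_integrable_def f_def .
  have nn: "f x \<ge> 0" for x
    by (simp add: f_def gen_airy_weight_def indicator_def)
  have L: "airy_functional t lam (p * p) = integral\<^sup>L lborel f"
    by (simp add: airy_functional_def set_lebesgue_integral_def f_def)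
  have "integral\<^sup>L lborel f \<noteq> 0"
  proof
    assume "integral\<^sup>L lborel f = 0"
    hence ae: "AE x in lborel. f x = 0"
      using integral_nonneg_eq_0_iff_AE[OF int] nn by simp
    have "finite {x. poly p x = 0}" using p by (rule poly_roots_finite)
    hence "{x. poly p x = 0} \<in> null_sets lborel"
      by (rule finite_imp_null_set_lborel)
    hence "AE x in lborel. poly p x \<noteq> 0"
      by (rule AE_I') auto
    with ae have "AE x in lborel. x \<notin> {0::real<..}"
      by eventually_elim (auto simp: f_def gen_airy_weight_def)
    hence "emeasure lborel {0::real<..} = 0"
      using AE_iff_measurable[where N = "{0::real<..}" and M = lborel and P = "\<lambda>x::real. x \<notin> {0<..}"]
      by (simp add: greaterThan_def)
    moreover have "emeasure lborel {0::real<..<1} \<le> emeasure lborel {0::real<..}"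
      by (intro emeasure_mono) auto
    ultimately show False by simp
  qed
  thus ?thesis using L integral_nonneg_AE[where M = lborel and f = f] nn by (simp add: order_less_le)
qed

text \<open>
  The integrand is the derivative of \<open>x w(x) p(x)\<close>.  This function tends to 0 at 0, because
  \<open>\<lambda> + 1 > 0\<close>, and at infinity, because of the cubic in the exponent.
\<close>

lemma airy_functional_pearson:
  assumes lam: "lam > -1"
  shows "airy_functional t lam ([:0, 1:] * pderiv p + [:lam + 1, t, 0, -1:] * p) = 0"
proof -
  \<comment> \<open>\<open>F\<close> and \<open>G\<close> are both \<open>x w(x) p(x)\<close> on the half line: \<open>F\<close> as a sum over monomials,
      whose limits are elementary, and \<open>G\<close> as a product, which is easy to differentiate.\<close>
  define F where "F = (\<lambda>x. \<Sum>k\<le>degree p. coeff p k *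
     (x powr (lam + 1 + real k) * exp (- (1/3) * x ^ 3 + t * x)))"
  define G where "G = (\<lambda>x. poly p x * (x powr (lam + 1) * exp (- (1/3) * x ^ 3 + t * x)))"
  define q where "q = [:0, 1:] * pderiv p + [:lam + 1, t, 0, -1:] * p"
  define f where "f = (\<lambda>x. poly q x * gen_airy_weight t lam x)"
  have FG: "F x = G x" if "x > 0" for x
    using that unfolding F_def G_def poly_altdef sum_distrib_right
    by (intro sum.cong) (simp_all add: powr_add powr_realpow mult_ac)
  have zero: "((\<lambda>x. x powr (lam + 1 + real k) * exp (- (1/3) * x ^ 3 + t * x)) \<longlongrightarrow> 0) (at_right 0)"
    and infinity: "((\<lambda>x. x powr (lam + 1 + real k) * exp (- (1/3) * x ^ 3 + t * x)) \<longlongrightarrow> 0) at_top" for k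
  proof -
    have "lam + 1 + real k > 0" using lam by simp
    thus "((\<lambda>x. x powr (lam + 1 + real k) * exp (- (1/3) * x ^ 3 + t * x)) \<longlongrightarrow> 0) (at_right 0)"
      by real_asymp
    show "((\<lambda>x. x powr (lam + 1 + real k) * exp (- (1/3) * x ^ 3 + t * x)) \<longlongrightarrow> 0) at_top"
      by real_asymp
  qed
  have "(F \<longlongrightarrow> (\<Sum>k\<le>degree p. coeff p k * 0)) (at_right 0)"
    unfolding F_def by (intro tendsto_intros zero)
  hence "(G \<longlongrightarrow> 0) (at_right 0)"
    using tendsto_cong[of F G, OF eventually_mono[OF eventually_at_right_less[of 0] FG]] by simp
  moreover have "(F \<longlongrightarrow> (\<Sum>k\<le>degree p. coeff p k * 0)) at_top"
    unfolding F_def by (intro tendsto_intros infinity)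
  hence "(G \<longlongrightarrow> 0) at_top"
    using tendsto_cong[of F G, OF eventually_mono[OF eventually_gt_at_top[of 0] FG]] by simp
  moreover have "(G has_vector_derivative f x) (at x)" if "x > 0" for x
  proof -
    have d1: "((\<lambda>x. x powr (lam + 1)) has_real_derivative (lam + 1) * x powr lam) (at x)"
      using has_real_derivative_powr[OF that, of "lam + 1"] by simp
    have d2: "((\<lambda>x. exp (- (1/3) * x ^ 3 + t * x)) has_real_derivative
        (t - x ^ 2) * exp (- (1/3) * x ^ 3 + t * x)) (at x)"
      by (auto intro!: derivative_eq_intros)
    have "(G has_real_derivative f x) (at x)"
      unfolding G_def
    proof (rule DERIV_cong[OF DERIV_mult[OF poly_DERIV DERIV_mult[OF d1 d2]]])
      define e where "e = exp (- (1/3) * x ^ 3 + t * x)"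
      have "x powr (lam + 1) = x powr lam * x" using that by (simp add: powr_add)
      thus "poly (pderiv p) x * (x powr (lam + 1) * exp (- (1/3) * x ^ 3 + t * x))
          + ((lam + 1) * x powr lam * exp (- (1/3) * x ^ 3 + t * x)
             + (t - x ^ 2) * exp (- (1/3) * x ^ 3 + t * x) * x powr (lam + 1)) * poly p x = f x"
        unfolding f_def q_def gen_airy_weight_def e_def[symmetric]
        by (simp add: algebra_simps power2_eq_square)
    qed
    thus ?thesis by (simp add: has_real_derivative_iff_has_vector_derivative)
  qed
  moreover have "isCont f x" if "x > 0" for x
    unfolding f_def gen_airy_weight_def using that by (intro continuous_intros) auto
  moreover have "einterval 0 \<infinity> = {0::real<..}" by (auto simp: einterval_def)
  moreover have "set_integrable lborel {0<..} f"
    unfolding f_def by (rule poly_times_airy_weight_integrable[OF lam])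
  ultimately have "(LBINT x=ereal 0..\<infinity>. f x) = 0 - 0"
    by (intro interval_integral_FTC_integrable[where F = G])
      (auto simp: ereal_tendsto_simps zero_ereal_def)
  thus ?thesis
    by (simp add: interval_lebesgue_integral_0_infty zero_ereal_def[symmetric] airy_functional_def f_def q_def)
qed

section \<open>Orthogonal polynomials for a functional with an Airy-type Pearson equation\<close>

text \<open>
  The elimination step in a form that is valid in every commutative ring: \<open>p\<^sub>1\<close>, \<open>p\<^sub>2\<close>, \<open>q\<^sub>1\<close> and
  \<open>c'\<close> stand for derivatives and \<open>q\<close> for the neighbour of \<open>p\<close>.  The three differences in
  parentheses on the right are the first-order relation for \<open>p\<close>, its derivative, and the relation for
  \<open>q\<close>; their multipliers are chosen such that \<open>q\<close> and \<open>q\<^sub>1\<close> cancel.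
\<close>

lemma eliminate_neighbour:
  fixes x c c' v b d e p p\<^sub>1 p\<^sub>2 q q\<^sub>1 :: "'a::comm_ring_1"
  shows "c * x * x * p\<^sub>2 + (x * (1 - v) * c - x * x * c') * p\<^sub>1
       + ((x * b + d * (v - d) + b * e * c) * c + x * c' * d) * p
     = c * x * ((p\<^sub>1 + x * p\<^sub>2) - (d * p\<^sub>1 - b * p + b * (c' * q + c * q\<^sub>1)))
       + b * c * c * (x * q\<^sub>1 - ((v - d) * q - e * p))
       - (c * (v - d) + x * c') * (x * p\<^sub>1 - (d * p + b * (c * q)))"
  by (simp add: algebra_simps)

locale semiclassical_airy =
  fixes L :: "real poly \<Rightarrow> real" and t lam :: real
    and P :: "nat \<Rightarrow> real poly" and \<alpha> \<beta> :: "int \<Rightarrow> real"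
  assumes L_add: "L (p + q) = L p + L q"
    and L_smult: "L (smult c p) = c * L p"
    and L_square_pos: "p \<noteq> 0 \<Longrightarrow> L (p * p) > 0"
    and pearson: "L ([:0, 1:] * pderiv p + [:lam + 1, t, 0, -1:] * p) = 0"
    and degree_P: "degree (P n) = n"
    and monic_P: "lead_coeff (P n) = 1"
    and orthogonal: "m \<noteq> n \<Longrightarrow> L (P m * P n) = 0"
    and recurrence: "recurrence_coeffs P \<alpha> \<beta>"
begin

abbreviation X :: "real poly" where "X \<equiv> [:0, 1:]"

text \<open>
  The polynomial \<open>P\<^sub>n\<^sub>-\<^sub>1\<close> with the convention \<open>P\<^sub>-\<^sub>1 = 0\<close>, which makes the recurrence and the
  structure relation hold uniformly from \<open>n = 0\<close> on.
\<close>

definition P_prev :: "nat \<Rightarrow> real poly" where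
  "P_prev n = (if n = 0 then 0 else P (n - 1))"

definition C :: "int \<Rightarrow> real poly" where
  "C n = [:\<beta> n + \<beta> (n + 1) + (\<alpha> n)\<^sup>2 - t, \<alpha> n, 1:]"

definition D :: "int \<Rightarrow> real poly" where
  "D n = [:\<alpha> (n - 1) + \<alpha> n, 1:]"

definition B :: "int \<Rightarrow> real poly" where
  "B n = of_int n - smult (\<beta> n) (D n)"

lemma P_prev_0 [simp]: "P_prev 0 = 0" and P_prev_Suc [simp]: "P_prev (Suc n) = P n"
  by (simp_all add: P_prev_def)

lemma beta_0 [simp]: "\<beta> 0 = 0"
  using recurrence by (simp add: recurrence_coeffs_def)

lemma X_times_P:
  "X * P n = P (Suc n) + smult (\<alpha> (int n)) (P n) + smult (\<beta> (int n)) (P_prev n)"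
  using recurrence unfolding recurrence_coeffs_def P_prev_def by blast

lemma L_0 [simp]: "L 0 = 0"
  using L_smult[of 0 0] by simp

lemma L_diff: "L (p - q) = L p - L q"
  using L_add[of p "smult (-1) q"] L_smult[of "-1" q] by simp

lemma coeff_P_eq_0: "i > n \<Longrightarrow> coeff (P n) i = 0"
  by (simp add: coeff_eq_0 degree_P)

lemma coeff_P_self: "coeff (P n) n = 1"
  using monic_P[of n] by (simp add: degree_P)

lemma coeff_P_prev_eq_0: "i \<ge> n \<Longrightarrow> coeff (P_prev n) i = 0"
  by (cases n) (auto simp: coeff_P_eq_0)

text \<open>
  Subtracting a multiple of \<open>P k\<close> removes the coefficient of degree \<open>k\<close>, so induction on the degree
  bound reduces the claim to the orthogonality of the \<open>P k\<close>.  Bounding the degree through vanishing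
  coefficients covers the zero polynomial, also for the bound 0.
\<close>

lemma orthogonal_lower:
  assumes "\<And>i. i \<ge> k \<Longrightarrow> coeff q i = 0" "k \<le> n"
  shows "L (P n * q) = 0"
  using assms
proof (induction k arbitrary: q)
  case 0
  then have "q = 0" by (simp add: poly_eq_iff)
  then show ?case by simp
next
  case (Suc k)
  define q' where "q' = q - smult (coeff q k) (P k)"
  have "coeff q' i = 0" if "i \<ge> k" for i
    using Suc.prems(1)[of i] that by (cases "i = k") (auto simp: q'_def coeff_P_self coeff_P_eq_0)
  then have "L (P n * q') = 0" using Suc by auto
  moreover have "L (P n * q) = L (P n * q') + coeff q k * L (P n * P k)"
    unfolding q'_def by (simp add: algebra_simps L_diff L_smult)
  ultimately show ?case using orthogonal[of n k] Suc.prems(2) by simp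
qed

lemma L_X_times_P:
  "L (X * P n * q) =
     L (P (Suc n) * q) + \<alpha> (int n) * L (P n * q) + \<beta> (int n) * L (P_prev n * q)"
  unfolding X_times_P by (simp add: algebra_simps L_add L_smult)

text \<open>
  The Euler operator \<open>x d/dx\<close> multiplies \<open>x\<^sup>n\<close> by \<open>n\<close>.
\<close>

lemma coeff_X_pderiv_P_eq_0:
  assumes "i \<ge> n"
  shows "coeff (X * pderiv (P n) - smult (real n) (P n)) i = 0"
  using assms by (cases "i = n"; cases i)
    (auto simp: coeff_pCons coeff_pderiv coeff_P_eq_0)

text \<open>
  The difference \<open>R\<close> of the two sides has degree below \<open>n\<close> and is orthogonal to every \<open>q\<close> of degree
  below \<open>n\<close>.  For the latter, integration by parts gives
  \<open>L (x P\<^sub>n' q) = L (P\<^sub>n (x\<^sup>3 - t x) q)\<close>, and the recurrence reduces both this and the right-hand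
  side to the same combination of \<open>L (P\<^sub>n\<^sub>-\<^sub>1 q)\<close>, \<open>L (P\<^sub>n\<^sub>-\<^sub>1 x q)\<close> and
  \<open>L (P\<^sub>n\<^sub>-\<^sub>1 x\<^sup>2 q)\<close>.  So \<open>L (R R) = 0\<close>, and \<open>R = 0\<close> by positivity.
\<close>

lemma structure_relation:
  "X * pderiv (P n) = B (int n) * P n + smult (\<beta> (int n)) (C (int n) * P_prev n)"
proof (cases n)
  case 0
  then have "pderiv (P n) = 0" using degree_P[of n] by (simp add: pderiv_eq_0_iff)
  then show ?thesis using 0 by (simp add: B_def)
next
  case (Suc m)
  define a b where "a = \<alpha> (int n)" and "b = \<beta> (int n)"
  define R where "R = X * pderiv (P n) - (B (int n) * P n + smult b (C (int n) * P_prev n))"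
  define Z where "Z = smult (\<alpha> (int m) + a) (smult (\<alpha> (int m)) (P m) + smult (\<beta> (int m)) (P_prev m))
     + smult (\<beta> (int m)) (X * P_prev m) + smult (b + \<beta> (int n + 1) + a\<^sup>2 - t) (P m)"
  \<comment> \<open>The terms of degree \<open>n + 1\<close> and \<open>n\<close> cancel here: \<open>Z\<close> has degree at most \<open>n - 1\<close>.\<close>
  have "D (int n) * P n - C (int n) * P_prev n = - Z"
  proof -
    have [simp]: "int n - 1 = int m" using Suc by simp
    have Pn: "P n = X * P m - smult (\<alpha> (int m)) (P m) - smult (\<beta> (int m)) (P_prev m)"
      using X_times_P[of m] Suc by simp
    show ?thesis unfolding Z_def D_def C_def Suc P_prev_Suc
      unfolding Suc[symmetric] Pn a_def b_def
      by (simp add: algebra_simps smult_add_left smult_add_right power2_eq_square)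
  qed
  then have R: "R = (X * pderiv (P n) - smult (real n) (P n)) - smult b Z"
    unfolding R_def B_def b_def
    by (simp add: algebra_simps of_nat_poly flip: smult_add_right smult_diff_right)
  have low: "coeff R i = 0" if "i \<ge> n" for i
  proof -
    have "coeff (X * pderiv (P n) - smult (real n) (P n)) i = 0"
      using that by (rule coeff_X_pderiv_P_eq_0)
    moreover have "coeff Z i = 0"
      using that Suc by (cases i) (auto simp: Z_def coeff_pCons coeff_P_eq_0 coeff_P_prev_eq_0)
    ultimately show ?thesis by (simp add: R)
  qed
  have "L (R * q) = 0" if q: "\<And>i. i \<ge> n \<Longrightarrow> coeff q i = 0" for q
  proof -
    define X_q' where "X_q' = X * pderiv q"
    have "coeff X_q' i = 0" if "i \<ge> n" for i
      using that q[of i] by (cases i) (auto simp: X_q'_def coeff_pderiv)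
    then have q': "L (P n * X_q') = 0" by (rule orthogonal_lower) auto
    have q0: "L (P n * q) = 0" "L (P (Suc n) * q) = 0" "L (P (Suc (Suc n)) * q) = 0"
      by (rule orthogonal_lower[of n], use q in auto)+
    \<comment> \<open>The recurrence lowers \<open>L (P n * (X ^ j * q))\<close> for \<open>j \<le> 3\<close> to the three quantities \<open>u\<close>, \<open>v\<close>, \<open>w\<close>.\<close>
    define u v w where "u = L (P m * q)" and "v = L (P m * (X * q))" and "w = L (P m * (X * X * q))"
    have x1: "L (P n * (X * q)) = b * u"
      using L_X_times_P[of n q] q0 Suc by (simp add: u_def b_def mult_ac)
    have x1': "L (P (Suc n) * (X * q)) = 0" 
      using L_X_times_P[of "Suc n" q] q0 by (simp add: mult_ac)
    have x2: "L (P n * (X * X * q)) = a * b * u + b * v"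
      using L_X_times_P[of n "X * q"] x1 x1' Suc by (simp add: u_def v_def a_def b_def mult_ac)
    have "L (P (Suc (Suc (Suc n))) * q) = 0"
      by (rule orthogonal_lower[of n]) (use q in auto)
    then have x2': "L (P (Suc n) * (X * X * q)) = \<beta> (int n + 1) * b * u"
      using L_X_times_P[of "Suc n" "X * q"] L_X_times_P[of "Suc (Suc n)" q] q0 x1 x1'
      by (simp add: ac_simps)
    have x3: "L (P n * (X * X * X * q)) =
        \<beta> (int n + 1) * b * u + a * (a * b * u + b * v) + b * w"
      using L_X_times_P[of n "X * X * q"] x2 x2' Suc by (simp add: w_def a_def b_def mult_ac)
    have "L (X * pderiv (P n) * q) =
        L (X * pderiv (P n * q) + [:lam + 1, t, 0, -1:] * (P n * q)) - L (P n * X_q')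
        - (lam + 1) * L (P n * q) - t * L (P n * (X * q)) + L (P n * (X * X * X * q))"
      unfolding X_q'_def L_smult[symmetric] L_add[symmetric] L_diff[symmetric]
      by (rule arg_cong[where f = L]) (simp add: pderiv_mult algebra_simps smult_add_left)
    also have "\<dots> = L (P n * (X * X * X * q)) - t * L (P n * (X * q))"
      by (simp only: pearson q' q0)
    finally have lhs: "L (X * pderiv (P n) * q) =
        L (P n * (X * X * X * q)) - t * L (P n * (X * q))" .
    have "L ((B (int n) * P n + smult b (C (int n) * P_prev n)) * q) =
        (real n - b * (\<alpha> (int n - 1) + a)) * L (P n * q) - b * L (P n * (X * q))
        + b * ((b + \<beta> (int n + 1) + a\<^sup>2 - t) * u + a * v + w)"
    proof -
      \<comment> \<open>A variable \<open>Y\<close> in the place of \<open>X\<close> keeps the simplifier from evaluating products with \<open>X\<close>.\<close>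
      have expand: "((smult (real n) 1 - smult b (smult s 1 + Y)) * p
            + smult b ((smult e 1 + smult a Y + Y * Y) * r)) * q
          = smult (real n - b * s) (p * q) - smult b (p * (Y * q))
            + smult b (smult e (r * q) + smult a (r * (Y * q)) + r * (Y * Y * q))"
        for Y p r and s e :: real
        by (simp add: algebra_simps smult_add_left smult_add_right smult_diff_left smult_diff_right)
      have "B (int n) = smult (real n) 1 - smult b (smult (\<alpha> (int n - 1) + a) 1 + X)"
        by (simp add: B_def D_def a_def b_def of_nat_poly)
      moreover have prev: "P_prev n = P m" using Suc by simp
      moreover have "C (int n) = smult (b + \<beta> (int n + 1) + a\<^sup>2 - t) 1 + smult a X + X * X"
        by (simp add: C_def a_def b_def)
      ultimately show ?thesis
        by (simp only: expand prev L_add L_diff L_smult u_def v_def w_def)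
    qed
    note rhs = this
    have "L (R * q) = L (X * pderiv (P n) * q)
        - L ((B (int n) * P n + smult b (C (int n) * P_prev n)) * q)"
      by (simp only: R_def left_diff_distrib L_diff)
    then show ?thesis
      unfolding lhs rhs x1 x3 q0 by (simp add: algebra_simps power2_eq_square)
  qed
  then have "L (R * R) = 0" using low by blast
  then have "R = 0" using L_square_pos[of R] by fastforce
  then show ?thesis by (simp add: R_def b_def)
qed

lemma orthogonal_P_prev: "n \<le> m \<Longrightarrow> L (P m * P_prev n) = 0"
  by (cases n) (auto simp: orthogonal)

lemma norm_P_Suc: "L (P (Suc n) * P (Suc n)) = \<beta> (int n + 1) * L (P n * P n)"
  using L_X_times_P[of n "P (Suc n)"] L_X_times_P[of "Suc n" "P n"]
    orthogonal_P_prev[of n "Suc n"] orthogonal[of "Suc (Suc n)" n]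
    orthogonal[of "Suc n" n] orthogonal[of n "Suc n"]
  by (simp add: mult_ac add.commute)

text \<open>
  The Pearson identity for \<open>P\<^sub>n\<^sup>2\<close>, divided by \<open>h = L (P\<^sub>n\<^sup>2)\<close>.  The derivative contributes
  \<open>2 n h\<close>, and \<open>L (x\<^sup>3 P\<^sub>n\<^sup>2) = L (x (x P\<^sub>n)\<^sup>2)\<close> is evaluated by expanding both factors
  \<open>x P\<^sub>n\<close> with the recurrence.
\<close>

lemma freud_equation:
  "2 * real n + 1 + lam = \<alpha> (int n) ^ 3 - t * \<alpha> (int n)
     + \<beta> (int n) * (\<alpha> (int n - 1) + 2 * \<alpha> (int n))
     + \<beta> (int n + 1) * (2 * \<alpha> (int n) + \<alpha> (int n + 1))"
proof -
  define a b b' where "a = \<alpha> (int n)" and "b = \<beta> (int n)" and "b' = \<beta> (int n + 1)"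
  define h k where "h = L (P n * P n)" and "k = L (P_prev n * P_prev n)"
  define p p' r where "p = P n" and "p' = P (Suc n)" and "r = P_prev n"
  have "P n \<noteq> 0" using coeff_P_self[of n] by auto
  then have h: "h \<noteq> 0" unfolding h_def using L_square_pos by fastforce
  have h': "L (p' * p') = b' * h"
    unfolding p'_def b'_def h_def by (rule norm_P_Suc)
  \<comment> \<open>For \<open>n > 0\<close> the norms satisfy \<open>h = b * k\<close>.  This fails for \<open>n = 0\<close>, where \<open>k = 0\<close>; the
      additional factor \<open>b\<close>, which is then 0, covers both cases.\<close>
  have k: "b * (b * k) = b * h"
    using norm_P_Suc[of "n - 1"] by (cases n) (auto simp: b_def h_def k_def add.commute)
  have rk: "b * (b * L (X * r * r)) = b * (\<alpha> (int n - 1) * h)"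
  proof (cases n)
    case (Suc m)
    have "L (X * P m * P m) = \<alpha> (int m) * k"
      using L_X_times_P[of m "P m"] orthogonal[of "Suc m" m] orthogonal_P_prev[of m m] Suc
      by (simp add: k_def mult_ac)
    then show ?thesis using k Suc by (auto simp: r_def algebra_simps)
  qed (simp add: b_def)
  have o: "L (p * p') = 0" "L (p * r) = 0" "L (p' * r) = 0" "L (P (Suc (Suc n)) * r) = 0"
    "L (P (Suc (Suc n)) * p') = 0" "L (p' * p) = 0" "L (r * p) = 0"
    using orthogonal_P_prev[of n] orthogonal
    by (simp_all add: p_def p'_def r_def mult.commute[of "P_prev n"])
  have pp: "L (X * p * p) = a * h" and pp': "L (X * p * p') = b' * h" and pr: "L (X * p * r) = b * k"
    using L_X_times_P[of n p] L_X_times_P[of n p'] L_X_times_P[of n r] o h' orthogonal_P_prev[of "n" "Suc n"]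
    by (simp_all add: p_def p'_def r_def a_def b_def h_def k_def mult_ac)
  have p'p': "L (X * p' * p') = \<alpha> (int n + 1) * b' * h" and p'r: "L (X * p' * r) = 0"
    using L_X_times_P[of "Suc n" p'] L_X_times_P[of "Suc n" r] o h'
    by (simp_all add: p_def p'_def r_def ac_simps)
  have "L (X * X * X * p * p) = L (X * (X * p) * (X * p))" by (simp add: mult_ac)
  also have "X * p = p' + smult a p + smult b r"
    unfolding p_def p'_def r_def a_def b_def by (rule X_times_P)
  also have "L (X * (p' + smult a p + smult b r) * (p' + smult a p + smult b r)) =
      L (X * p' * p') + a * a * L (X * p * p) + b * (b * L (X * r * r))
      + (a * L (X * p * p') + a * L (X * p * p'))
      + (a * b * L (X * p * r) + a * b * L (X * p * r)) + (b * L (X * p' * r) + b * L (X * p' * r))"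
    unfolding L_smult[symmetric] L_add[symmetric]
    by (rule arg_cong[where f = L]) (simp add: algebra_simps smult_add_left smult_add_right)
  also have "\<dots> = h * (a ^ 3 + b * (\<alpha> (int n - 1) + 2 * a) + b' * (2 * a + \<alpha> (int n + 1)))"
    unfolding pp pp' pr p'p' p'r rk using k by (simp add: algebra_simps power3_eq_cube)
  finally have cube: "L (X * X * X * p * p) =
      h * (a ^ 3 + b * (\<alpha> (int n - 1) + 2 * a) + b' * (2 * a + \<alpha> (int n + 1)))" .
  have "L (P n * (X * pderiv (P n) - smult (real n) (P n))) = 0"
    by (rule orthogonal_lower[of n, OF coeff_X_pderiv_P_eq_0]) simp_all
  then have deriv: "L (p * (X * pderiv p)) = real n * h"
    unfolding right_diff_distrib L_diff by (simp add: L_smult p_def h_def)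
  have "0 = L (X * pderiv (p * p) + [:lam + 1, t, 0, -1:] * (p * p))"
    by (simp only: pearson)
  also have "\<dots> = (L (p * (X * pderiv p)) + L (p * (X * pderiv p))) + (lam + 1) * L (p * p) + t * L (X * p * p)
      - L (X * X * X * p * p)"
    unfolding L_smult[symmetric] L_add[symmetric] L_diff[symmetric]
    by (rule arg_cong[where f = L]) (simp add: pderiv_mult algebra_simps smult_add_left)
  also have "\<dots> = h * (2 * real n + lam + 1 + t * a
      - (a ^ 3 + b * (\<alpha> (int n - 1) + 2 * a) + b' * (2 * a + \<alpha> (int n + 1))))"
    unfolding deriv pp cube by (simp add: h_def p_def algebra_simps)
  finally show ?thesis using h by (simp add: a_def b_def b'_def)
qed

text \<open>
  For the weight \<open>w\<close> this is \<open>- x w' / w\<close>, that is, \<open>x\<close> times the derivative of the potential.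
\<close>

definition V :: "real poly" where
  "V = [:- lam, - t, 0, 1:]"

text \<open>
  In the structure relation the recurrence replaces \<open>\<beta>\<^sub>n P\<^sub>n\<^sub>-\<^sub>1\<close> by
  \<open>(x - \<alpha>\<^sub>n) P\<^sub>n - P\<^sub>n\<^sub>+\<^sub>1\<close>.  In the resulting coefficient of \<open>P\<^sub>n\<close> all powers of \<open>x\<close> match
  those of \<open>V - B\<^sub>n\<^sub>+\<^sub>1\<close> directly; equality of the constant terms is the Freud equation.
\<close>

lemma lower_structure_relation:
  "X * pderiv (P n) = (V - B (int n + 1)) * P n - C (int n) * P (Suc n)"
proof -
  have coeffs: "B (int n) + C (int n) * [:- \<alpha> (int n), 1:] = V - B (int n + 1)"
    using freud_equation[of n]
    by (simp add: B_def C_def D_def V_def one_pCons of_nat_poly algebra_simps power2_eq_square power3_eq_cube)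
  have "X * pderiv (P n) = B (int n) * P n + C (int n) * smult (\<beta> (int n)) (P_prev n)"
    unfolding structure_relation by simp
  also have "smult (\<beta> (int n)) (P_prev n) = [:- \<alpha> (int n), 1:] * P n - P (Suc n)"
    using X_times_P[of n] by simp
  also have "B (int n) * P n + C (int n) * \<dots> =
      (B (int n) + C (int n) * [:- \<alpha> (int n), 1:]) * P n - C (int n) * P (Suc n)"
    by (simp only: algebra_simps)
  finally show ?thesis unfolding coeffs .
qed

text \<open>
  For \<open>n > 0\<close> this is the elimination of \<open>P\<^sub>n\<^sub>-\<^sub>1\<close>.  For \<open>n = 0\<close> there is no relation for
  \<open>P\<^sub>-\<^sub>1\<close>, but \<open>P\<^sub>0' = 0\<close>, \<open>\<beta>\<^sub>0 = 0\<close> and \<open>B\<^sub>0 = 0\<close> make every term vanish.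
\<close>

lemma polynomial_ode:
  "C (int n) * X * X * pderiv (pderiv (P n))
     + (X * (1 - V) * C (int n) - X * X * pderiv (C (int n))) * pderiv (P n)
     + ((X * [:\<beta> (int n):] + B (int n) * (V - B (int n))
          + [:\<beta> (int n):] * C (int n - 1) * C (int n)) * C (int n)
        + X * pderiv (C (int n)) * B (int n)) * P n = 0"
proof (cases n)
  case 0
  then have "pderiv (P n) = 0" using degree_P[of n] by (simp add: pderiv_eq_0_iff)
  moreover have "B (int n) = 0" using 0 by (simp add: B_def)
  ultimately show ?thesis using 0 by simp
next
  case (Suc m)
  define c c' d b where "c = C (int n)" and "c' = pderiv c" and "d = B (int n)" and "b = [:\<beta> (int n):]"
  define p q where "p = P n" and "q = P m"
  have e1: "X * pderiv p = d * p + b * (c * q)"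
    using structure_relation[of n] by (simp add: Suc p_def q_def b_def c_def d_def)
  have pd: "pderiv d = - b"
    by (simp add: d_def b_def B_def D_def of_nat_poly pderiv_diff pderiv_smult pderiv_pCons)
  have pb: "pderiv b = 0" by (simp add: b_def pderiv_pCons)
  have pX: "pderiv X = 1" by (simp add: pderiv_pCons)
  have "pderiv p + X * pderiv (pderiv p) = pderiv (X * pderiv p)"
    by (simp only: pderiv_mult pX mult_1_right add.commute)
  also have "\<dots> = d * pderiv p + p * (- b) + (b * (c * pderiv q + q * c') + c * q * 0)"
    by (simp only: e1 pderiv_add pderiv_mult pb pd c'_def)
  also have "\<dots> = d * pderiv p - b * p + b * (c' * q + c * pderiv q)"
    by (simp only: mult.commute mult_minus_right mult_zero_right add_0_right add.commute diff_conv_add_uminus)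
  finally have e2: "pderiv p + X * pderiv (pderiv p) =
      d * pderiv p - b * p + b * (c' * q + c * pderiv q)" .
  have e3: "X * pderiv q = (V - d) * q - C (int n - 1) * p"
    using lower_structure_relation[of m] by (simp add: Suc p_def q_def d_def add.commute)
  have "c * X * X * pderiv (pderiv p) + (X * (1 - V) * c - X * X * c') * pderiv p
     + ((X * b + d * (V - d) + b * C (int n - 1) * c) * c + X * c' * d) * p
     = c * X * ((pderiv p + X * pderiv (pderiv p))
          - (d * pderiv p - b * p + b * (c' * q + c * pderiv q)))
       + b * c * c * (X * pderiv q - ((V - d) * q - C (int n - 1) * p))
       - (c * (V - d) + X * c') * (X * pderiv p - (d * p + b * (c * q)))"
    by (rule eliminate_neighbour)
  also have "\<dots> = 0"
    unfolding e1 e2 e3 by simp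
  finally show ?thesis unfolding c'_def c_def d_def b_def p_def .
qed

end

section \<open>Passage to rational functions\<close>

text \<open>
  Division of the polynomial equation by \<open>x\<^sup>2 c\<close>.  Here \<open>n\<^sub>2 = x c' - c\<close>: writing
  \<open>x c' d / c = d + d n\<^sub>2 / c\<close> moves a summand \<open>d\<close> to the terms free of \<open>c\<close> in the denominator.
\<close>

lemma ode_field_form:
  fixes x c c' v b d e n\<^sub>2 p p\<^sub>1 p\<^sub>2 :: "'a::field"
  assumes "x \<noteq> 0" "c \<noteq> 0" and euler: "x * c' = c + n\<^sub>2"
    and ode: "c * x * x * p\<^sub>2 + (x * (1 - v) * c - x * x * c') * p\<^sub>1
       + ((x * b + d * (v - d) + b * e * c) * c + x * c' * d) * p = 0"
  shows "p\<^sub>2 + ((1 - v) / x - c' / c) * p\<^sub>1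
       + ((x * b + d + d * (v - d) + b * e * c) / x ^ 2 + d * n\<^sub>2 / (x ^ 2 * c)) * p = 0"
proof -
  have "(x ^ 2 * c) * (p\<^sub>2 + ((1 - v) / x - c' / c) * p\<^sub>1
       + ((x * b + d + d * (v - d) + b * e * c) / x ^ 2 + d * n\<^sub>2 / (x ^ 2 * c)) * p)
     = c * x * x * p\<^sub>2 + (x * (1 - v) * c - x * x * c') * p\<^sub>1
       + ((x * b + d * (v - d) + b * e * c) * c + (c + n\<^sub>2) * d) * p"
    using assms(1,2) by (simp add: field_simps power2_eq_square)
  with ode euler assms(1,2) show ?thesis by simp
qed

lemma of_int_to_fract: "(of_int k :: 'a::idom fract) = to_fract (of_int k)"
proof -
  have "to_fract (of_nat m :: 'a) = of_nat m" for m by (induction m) simp_all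
  then show ?thesis by (cases k) (simp_all del: of_nat_Suc)
qed

context semiclassical_airy
begin

lemma airy_C_eq: "airy_C t \<alpha> \<beta> k = to_fract (C k)"
  unfolding airy_C_def power2_eq_square to_fract_add[symmetric] to_fract_mult[symmetric] to_fract_diff[symmetric]
  by (simp add: C_def power2_eq_square)

lemma airy_D_eq: "airy_D \<alpha> k = to_fract (D k)"
  unfolding airy_D_def to_fract_add[symmetric] by (simp add: D_def)

lemma airy_Q_eq:
  "airy_Q t lam \<alpha> \<beta> k = (1 - to_fract V) / rf_X - to_fract (pderiv (C k)) / to_fract (C k)"
proof -
  have "rf_const lam + rf_const t * rf_X - rf_X ^ 3 + 1 = to_fract ([:lam:] + [:t:] * X - X * X * X + 1)"
    by (simp only: to_fract_add to_fract_diff to_fract_mult to_fract_1 power3_eq_cube)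
  also have "\<dots> = 1 - to_fract V"
    unfolding to_fract_1[symmetric] to_fract_diff[symmetric] by (simp add: V_def one_pCons)
  moreover have "rf_const (\<alpha> k) + 2 * rf_X = to_fract ([:\<alpha> k:] + (X + X))"
    by (simp only: to_fract_add mult_2)
  moreover have "[:\<alpha> k:] + (X + X) = pderiv (C k)" by (simp add: C_def pderiv_pCons)
  ultimately show ?thesis by (simp only: airy_Q_def airy_C_eq)
qed

text \<open>
  The stated numerators are \<open>n - (\<alpha>\<^sub>n\<^sub>-\<^sub>1 + \<alpha>\<^sub>n) \<beta>\<^sub>n = x \<beta>\<^sub>n + B\<^sub>n\<close> and
  \<open>x\<^sup>2 - \<alpha>\<^sub>n\<^sup>2 - \<beta>\<^sub>n - \<beta>\<^sub>n\<^sub>+\<^sub>1 + t = x C\<^sub>n' - C\<^sub>n\<close> in disguise.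
\<close>

lemma airy_T_eq:
  "airy_T t lam \<alpha> \<beta> k =
     (rf_X * rf_const (\<beta> k) + to_fract (B k) + to_fract (B k) * (to_fract V - to_fract (B k))
        + rf_const (\<beta> k) * to_fract (C (k - 1)) * to_fract (C k)) / rf_X ^ 2
     + to_fract (B k) * to_fract (X * pderiv (C k) - C k) / (rf_X ^ 2 * to_fract (C k))"
proof -
  have B: "of_int k - rf_const (\<beta> k) * to_fract (D k) = to_fract (B k)"
    unfolding of_int_to_fract to_fract_diff[symmetric] to_fract_mult[symmetric] by (simp add: B_def)
  have 1: "of_int k - rf_const ((\<alpha> (k - 1) + \<alpha> k) * \<beta> k) = rf_X * rf_const (\<beta> k) + to_fract (B k)"
    unfolding of_int_to_fract to_fract_diff[symmetric] to_fract_mult[symmetric] to_fract_add[symmetric]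
    by (simp add: B_def D_def algebra_simps del: to_fract_add to_fract_mult to_fract_diff)
  have V: "- rf_const lam + y - of_int k - rf_const t * rf_X + rf_X ^ 3 = to_fract V - (of_int k - y)" for y
  proof -
    have "to_fract V = to_fract (- [:lam:] - [:t:] * X + X * X * X)"
      by (simp add: V_def del: to_fract_add to_fract_mult to_fract_diff to_fract_uminus)
    also have "\<dots> = - rf_const lam - rf_const t * rf_X + rf_X ^ 3"
      by (simp only: to_fract_add to_fract_diff to_fract_mult to_fract_uminus power3_eq_cube)
    finally show ?thesis by simp
  qed
  have N: "rf_X ^ 2 - rf_const ((\<alpha> k)\<^sup>2) - rf_const (\<beta> k) - rf_const (\<beta> (k + 1)) + rf_const t
      = to_fract (X * pderiv (C k) - C k)"
    unfolding power2_eq_square[of rf_X] to_fract_diff[symmetric] to_fract_mult[symmetric] to_fract_add[symmetric]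
    by (simp add: C_def pderiv_pCons algebra_simps)
  have neg: "u - (z - w) * s = u + (w - z) * s" for u z w s :: ratfun
    by (simp add: algebra_simps)
  show ?thesis
    unfolding airy_T_def airy_C_eq airy_D_eq V neg 1 B N ..
qed

lemma rational_ode:
  "to_fract (pderiv (pderiv (P n))) + airy_Q t lam \<alpha> \<beta> (int n) * to_fract (pderiv (P n))
     + airy_T t lam \<alpha> \<beta> (int n) * to_fract (P n) = 0"
  unfolding airy_Q_eq airy_T_eq
proof (rule ode_field_form)
  show "to_fract (C (int n)) \<noteq> 0" by (simp add: C_def)
  show "rf_X * to_fract (pderiv (C (int n))) =
      to_fract (C (int n)) + to_fract (X * pderiv (C (int n)) - C (int n))"
    by (simp only: to_fract_diff to_fract_mult)
  show "to_fract (C (int n)) * rf_X * rf_X * to_fract (pderiv (pderiv (P n)))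
     + (rf_X * (1 - to_fract V) * to_fract (C (int n)) - rf_X * rf_X * to_fract (pderiv (C (int n))))
         * to_fract (pderiv (P n))
     + ((rf_X * rf_const (\<beta> (int n)) + to_fract (B (int n)) * (to_fract V - to_fract (B (int n)))
          + rf_const (\<beta> (int n)) * to_fract (C (int n - 1)) * to_fract (C (int n))) * to_fract (C (int n))
        + rf_X * to_fract (pderiv (C (int n))) * to_fract (B (int n))) * to_fract (P n) = 0"
    using arg_cong[OF polynomial_ode[of n], of to_fract]
    by (simp only: to_fract_add to_fract_diff to_fract_mult to_fract_0 to_fract_1)
  show "rf_X \<noteq> 0" by simp
qed

end

theorem theorem3p5:
  fixes t lam :: real and P :: "nat \<Rightarrow> real poly" and \<alpha> \<beta> :: "int \<Rightarrow> real" and n :: nat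
  assumes "lam > -1"
    and "monic_orthogonal_polys (gen_airy_weight t lam) P"
    and "recurrence_coeffs P \<alpha> \<beta>"
  shows "to_fract (pderiv (pderiv (P n)))
           + airy_Q t lam \<alpha> \<beta> (int n) * to_fract (pderiv (P n))
           + airy_T t lam \<alpha> \<beta> (int n) * to_fract (P n) = 0"
proof -
  interpret semiclassical_airy "airy_functional t lam" t lam P \<alpha> \<beta>
  proof
    show "degree (P i) = i" "lead_coeff (P i) = 1" for i
      using assms(2) unfolding monic_orthogonal_polys_def by blast+
    show "airy_functional t lam (P i * P j) = 0" if "i \<noteq> j" for i j
      using assms(2) that by (simp add: monic_orthogonal_polys_def airy_functional_def)
    show "airy_functional t lam ([:0, 1:] * pderiv p + [:lam + 1, t, 0, -1:] * p) = 0" for p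
      using assms(1) by (rule airy_functional_pearson)
  qed (use assms in \<open>simp_all only: airy_functional_add airy_functional_smult
      airy_functional_square_pos not_False_eq_True\<close>)
  show ?thesis by (rule rational_ode)
qed

end
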